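(* For each integer $n\ge 1$, the path $P_n$ with $n$ vertices satisfies $$M(P_n)=\left\lfloor\frac{(n+1)^2}{4}\right\rfloor=\left\lfloor\frac{n+1}{2}\right\rfloor\cdot\left\lceil\frac{n+1}{2}\right\rceil.$$
   Context: Graphs are finite, simple and undirected. $P_n$ is the graph with vertex set $\{1,\dots,n\}$ and edge set $\{\{i,i+1\} : 1\le i\le n-1\}$ (for $n=1$ this is a single vertex without edges). For a graph $\mathcal{G}$ with $n$ vertices and adjacency matrix $A$, viewed over $\mathbb{F}_2$, let $C(\mathcal{G})\subseteq\mathbb{F}_2^{2n}$ be the binary linear code generated by the rows of $[I_n|A]$, where $I_n$ is the $n\times n$ identity matrix. The support of a vector is the set of positions of its nonzero entries. A nonzero codeword $c$ of a binary linear code $C$ is minimal if there is no nonzero codeword $c'\in C$ with $\operatorname{supp}(c')\subsetneq\operatorname{supp}(c)$. $M(\mathcal{G})$ denotes the number of minimal codewords of $C(\mathcal{G})$; it does not depend on the labeling of the vertices. *)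

theory Defs
  imports Complex_Main "HOL-Library.Z2" "Jordan_Normal_Form.VS_Connect"
begin

text \<open>A graph is a pair of a vertex set and a set of edges, the edges being two-element vertex sets.\<close>

type_synonym 'a ugraph = "'a set \<times> 'a set set"

definition simple_graph :: "'a ugraph \<Rightarrow> bool" where
  "simple_graph G \<longleftrightarrow>
     finite (fst G) \<and> (\<forall>e \<in> snd G. e \<subseteq> fst G \<and> card e = 2)"

definition path_graph :: "nat \<Rightarrow> nat ugraph" where
  "path_graph n = ({1..n}, {{i, i + 1} | i. 1 \<le> i \<and> i + 1 \<le> n})"

lemma simple_graph_path_graph: "simple_graph (path_graph n)"
  by (auto simp: simple_graph_def path_graph_def card_insert_if)

text \<open>Rows and columns are numbered from 0, following the increasing enumeration of the vertices.\<close>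

definition adjacency_matrix :: "'a::linorder ugraph \<Rightarrow> bit mat" where
  "adjacency_matrix G =
     (let vs = sorted_list_of_set (fst G); n = card (fst G)
      in mat n n (\<lambda>(i, j). if {vs ! i, vs ! j} \<in> snd G then 1 else 0))"

definition generator_matrix :: "'a::linorder ugraph \<Rightarrow> bit mat" where
  "generator_matrix G =
     (let n = card (fst G)
      in mat n (2 * n)
           (\<lambda>(i, j). if j < n then 1\<^sub>m n $$ (i, j) else adjacency_matrix G $$ (i, j - n)))"

definition graph_code :: "'a::linorder ugraph \<Rightarrow> bit vec set" where
  "graph_code G = vec_space.row_space (2 * card (fst G)) (generator_matrix G)"

definition vec_support :: "'a::zero vec \<Rightarrow> nat set" where
  "vec_support c = {i. i < dim_vec c \<and> c $ i \<noteq> 0}"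

definition minimal_codeword :: "'a::zero vec set \<Rightarrow> 'a vec \<Rightarrow> bool" where
  "minimal_codeword C c \<longleftrightarrow>
     c \<in> C \<and> c \<noteq> 0\<^sub>v (dim_vec c) \<and>
     \<not> (\<exists>c' \<in> C. c' \<noteq> 0\<^sub>v (dim_vec c') \<and> vec_support c' \<subset> vec_support c)"

definition num_minimal_codewords :: "'a::linorder ugraph \<Rightarrow> nat" where
  "num_minimal_codewords G = card {c. minimal_codeword (graph_code G) c}"

end

theory Submission
  imports Defs
begin

text \<open>
  A codeword of \<open>[I | A]\<close> is determined by the set \<open>S\<close> of rows that are added up, and its support
  consists of \<open>S\<close> and of the vertices having an odd number of neighbours in \<open>S\<close>, shifted by \<open>n\<close>.
  Hence the support of the codeword of \<open>T\<close> lies in that of the codeword of \<open>S\<close> iff \<open>T \<subseteq> S\<close> and every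
  vertex that sees an odd number of elements of \<open>T\<close> sees an odd number of elements of \<open>S\<close>.
  In a path, given \<open>T \<subseteq> S\<close>, the second condition says that a vertex \<open>k\<close> whose two neighbours
  \<open>k - 1\<close> and \<open>k + 1\<close> both lie in \<open>S\<close> has both or none of them in \<open>T\<close>. So the codeword of \<open>S\<close> is
  minimal iff \<open>S\<close> is connected under the relation ``at distance two'', that is, iff \<open>S\<close> is a
  progression \<open>a, a + 2, \<dots>, a + 2 m\<close> (lemma \<open>minimal_path_codeword_iff\<close>). It remains to count the
  pairs \<open>(a, m)\<close> with \<open>a + 2 m < n\<close>; there are \<open>(n + 1)\<^sup>2 div 4\<close> of them.
\<close>

section \<open>The codewords of a path\<close>

text \<open>The sum of the rows of the generator matrix of the path on \<open>n\<close> vertices that are indexed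
  by \<open>S\<close>. Like the rows, the vertices are numbered from 0 from here on: \<open>k\<close> stands for the vertex
  \<open>k + 1\<close>. The two summands are the contributions of the right and the left neighbour of \<open>j - n\<close>;
  membership in \<open>Suc ` S\<close> takes care of the vertex 0, which has no left neighbour, and the last
  vertex needs no such care as only sets \<open>S \<subseteq> {..<n}\<close> are considered.\<close>

definition path_codeword :: "nat \<Rightarrow> nat set \<Rightarrow> bit vec" where
  "path_codeword n S =
     vec (2 * n) (\<lambda>j. if j < n then of_bool (j \<in> S)
                      else of_bool (Suc (j - n) \<in> S) + of_bool (j - n \<in> Suc ` S))"

text \<open>The vertices with exactly one neighbour in \<open>S\<close>. As no vertex of a path has more than two
  neighbours, these are the vertices with an odd number of neighbours in \<open>S\<close>.\<close>

definition odd_vertices :: "nat \<Rightarrow> nat set \<Rightarrow> nat set" where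
  "odd_vertices n S = {k. k < n \<and> (Suc k \<in> S) \<noteq> (k \<in> Suc ` S)}"

lemma generator_matrix_path_index:
  assumes "i < n" "j < 2 * n"
  shows "generator_matrix (path_graph n) $$ (i, j) =
    (if j < n then of_bool (i = j) else of_bool (j - n = Suc i \<or> i = Suc (j - n)))"
proof -
  have vs: "sorted_list_of_set {1..n} = [1..<Suc n]"
    by (metis atLeastLessThanSuc_atLeastAtMost sorted_list_of_set_range)
  have edge: "{Suc i, Suc k} \<in> {{i, i + 1} | i. 1 \<le> i \<and> i + 1 \<le> n} \<longleftrightarrow> k = Suc i \<or> i = Suc k"
    if "k < n" for k
    using that assms(1) by (auto simp: doubleton_eq_iff)
  show ?thesis
  proof (cases "j < n")
    case True
    then show ?thesis
      using assms by (simp add: generator_matrix_def path_graph_def)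
  next
    case False
    then have "j - n < n" using assms by auto
    then show ?thesis
      using assms False edge[of "j - n"]
      by (simp add: generator_matrix_def path_graph_def adjacency_matrix_def Let_def vs[unfolded One_nat_def]
          del: upt_Suc)
  qed
qed

lemma transpose_generator_matrix_path_mult:
  assumes "x \<in> carrier_vec n"
  shows "(generator_matrix (path_graph n))\<^sup>T *\<^sub>v x = path_codeword n (vec_support x)"
proof (rule eq_vecI)
  let ?G = "generator_matrix (path_graph n)"
  have dim: "dim_row ?G = n" "dim_col ?G = 2 * n"
    by (simp_all add: generator_matrix_def path_graph_def Let_def)
  have x: "x $ i = of_bool (i \<in> vec_support x)" if "i < n" for i
    using that assms by (cases "x $ i") (auto simp: vec_support_def)
  have supp: "i < n" if "i \<in> vec_support x" for i
    using that assms by (auto simp: vec_support_def)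
  show "dim_vec (?G\<^sup>T *\<^sub>v x) = dim_vec (path_codeword n (vec_support x))"
    by (simp add: dim path_codeword_def)
  fix j assume "j < dim_vec (path_codeword n (vec_support x))"
  then have j: "j < 2 * n" by (simp add: path_codeword_def)
  have "(?G\<^sup>T *\<^sub>v x) $ j = (\<Sum>i<n. ?G $$ (i, j) * x $ i)"
    using j assms by (simp add: dim scalar_prod_def atLeast0LessThan)
  also have "\<dots> = (\<Sum>i<n. (if j < n then of_bool (i = j)
      else of_bool (j - n = Suc i \<or> i = Suc (j - n))) * of_bool (i \<in> vec_support x))"
    using j by (intro sum.cong refl) (simp add: generator_matrix_path_index x)
  also have "\<dots> = path_codeword n (vec_support x) $ j"
  proof (cases "j < n")
    case True
    have "(\<Sum>i<n. of_bool (i = j) * of_bool (i \<in> vec_support x)) =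
        (\<Sum>i<n. if i = j then of_bool (i \<in> vec_support x) else (0 :: bit))"
      by (intro sum.cong) auto
    with True show ?thesis by (simp add: path_codeword_def)
  next
    case False
    define k where "k = j - n"
    have k: "k < n" using j False by (auto simp: k_def)
    have "(\<Sum>i<n. of_bool (k = Suc i \<or> i = Suc k) * of_bool (i \<in> vec_support x)) =
        (\<Sum>i<n. if i = Suc k then of_bool (i \<in> vec_support x) else (0 :: bit)) +
        (\<Sum>i<n. if i = k - 1 then of_bool (k \<noteq> 0 \<and> i \<in> vec_support x) else (0 :: bit))"
      unfolding sum.distrib[symmetric] by (intro sum.cong) auto
    also have "(\<Sum>i<n. if i = Suc k then of_bool (i \<in> vec_support x) else (0 :: bit)) =
        of_bool (Suc k \<in> vec_support x)"
      using supp[of "Suc k"] by (subst sum.delta) auto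
    also have "(\<Sum>i<n. if i = k - 1 then of_bool (k \<noteq> 0 \<and> i \<in> vec_support x) else (0 :: bit)) =
        of_bool (k \<noteq> 0 \<and> k - 1 \<in> vec_support x)"
      using k by (subst sum.delta) auto
    also have "(k \<noteq> 0 \<and> k - 1 \<in> vec_support x) = (k \<in> Suc ` vec_support x)"
      by (cases k) auto
    finally show ?thesis using False j by (simp add: path_codeword_def k_def)
  qed
  finally show "(?G\<^sup>T *\<^sub>v x) $ j = path_codeword n (vec_support x) $ j" .
qed

lemma graph_code_path: "graph_code (path_graph n) = path_codeword n ` Pow {..<n}"
proof -
  let ?G = "generator_matrix (path_graph n)"
  have dim: "dim_row ?G = n" "dim_col ?G = 2 * n"
    by (simp_all add: generator_matrix_def path_graph_def Let_def)
  have card: "card (fst (path_graph n)) = n" by (simp add: path_graph_def)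
  have mult: "?G\<^sup>T *\<^sub>v x = path_codeword n (vec_support x)" if "x \<in> carrier_vec n" for x
    by (rule transpose_generator_matrix_path_mult) fact
  have supports: "vec_support ` (carrier_vec n :: bit vec set) = Pow {..<n}"
  proof (intro equalityI subsetI)
    fix S assume "S \<in> Pow {..<n}"
    then have "S = vec_support (vec n (\<lambda>i. of_bool (i \<in> S)) :: bit vec)"
      by (auto simp: vec_support_def)
    then show "S \<in> vec_support ` (carrier_vec n :: bit vec set)"
      by (metis imageI vec_carrier)
  qed (auto simp: vec_support_def)
  have G: "?G \<in> carrier_mat n (2 * n)" using dim by (rule carrier_matI)
  then have "?G\<^sup>T *\<^sub>v x \<in> carrier_vec (2 * n)" if "x \<in> carrier_vec n" for x
    using that by (intro mult_mat_vec_carrier[of _ _ n]) simp_all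
  then have "graph_code (path_graph n) = (\<lambda>x. ?G\<^sup>T *\<^sub>v x) ` carrier_vec n"
    unfolding graph_code_def card vec_space.row_space_eq[OF G] dim by blast
  also have "\<dots> = path_codeword n ` vec_support ` (carrier_vec n :: bit vec set)"
    unfolding image_image using mult by (rule image_cong[OF refl])
  finally show ?thesis by (simp add: supports)
qed

lemma vec_support_path_codeword:
  assumes "S \<subseteq> {..<n}"
  shows "vec_support (path_codeword n S) = S \<union> (\<lambda>k. n + k) ` odd_vertices n S"
proof (rule Set.set_eqI)
  fix j
  show "j \<in> vec_support (path_codeword n S) \<longleftrightarrow> j \<in> S \<union> (\<lambda>k. n + k) ` odd_vertices n S"
  proof (cases "j < n")
    case True
    then show ?thesis by (auto simp: vec_support_def path_codeword_def)
  next
    case False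
    then obtain k where k: "j = n + k" by (metis le_Suc_ex not_less)
    have "j \<notin> S" using assms False by auto
    then show ?thesis
      by (auto simp: k vec_support_def path_codeword_def odd_vertices_def)
  qed
qed

lemma vec_support_path_codeword_mono_iff:
  assumes "S \<subseteq> {..<n}" "T \<subseteq> {..<n}"
  shows "vec_support (path_codeword n T) \<subseteq> vec_support (path_codeword n S) \<longleftrightarrow>
    T \<subseteq> S \<and> odd_vertices n T \<subseteq> odd_vertices n S"
proof
  assume *: "vec_support (path_codeword n T) \<subseteq> vec_support (path_codeword n S)"
  show "T \<subseteq> S \<and> odd_vertices n T \<subseteq> odd_vertices n S"
  proof (intro conjI subsetI)
    fix k assume "k \<in> T"
    then show "k \<in> S"
      using * assms by (fastforce simp: vec_support_path_codeword)
  next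
    fix k assume "k \<in> odd_vertices n T"
    then have "n + k \<in> S \<union> (\<lambda>k. n + k) ` odd_vertices n S"
      using * assms by (auto simp: vec_support_path_codeword)
    then show "k \<in> odd_vertices n S" using assms by auto
  qed
next
  assume "T \<subseteq> S \<and> odd_vertices n T \<subseteq> odd_vertices n S"
  then show "vec_support (path_codeword n T) \<subseteq> vec_support (path_codeword n S)"
    by (auto simp: vec_support_path_codeword assms)
qed

lemma inj_on_path_codeword: "inj_on (path_codeword n) (Pow {..<n})"
proof (rule inj_onI)
  fix S T assume ST: "S \<in> Pow {..<n}" "T \<in> Pow {..<n}" and eq: "path_codeword n S = path_codeword n T"
  then show "S = T"
    using vec_support_path_codeword_mono_iff[of S n T] vec_support_path_codeword_mono_iff[of T n S]
    by auto
qed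

lemma path_codeword_eq_0_iff:
  assumes "S \<subseteq> {..<n}"
  shows "path_codeword n S = 0\<^sub>v (dim_vec (path_codeword n S)) \<longleftrightarrow> S = {}"
proof -
  have "path_codeword n {} = 0\<^sub>v (2 * n)"
    by (auto simp: path_codeword_def)
  moreover have "dim_vec (path_codeword n S) = 2 * n"
    by (simp add: path_codeword_def)
  ultimately show ?thesis
    using inj_on_path_codeword[of n] assms by (auto dest!: inj_onD[of _ _ S "{}"])
qed

section \<open>Minimality in terms of vertex sets\<close>

lemma minimal_codeword_path_codeword_iff:
  assumes "S \<subseteq> {..<n}"
  shows "minimal_codeword (graph_code (path_graph n)) (path_codeword n S) \<longleftrightarrow>
    S \<noteq> {} \<and> (\<forall>T. T \<noteq> {} \<and> T \<subseteq> S \<and> odd_vertices n T \<subseteq> odd_vertices n S \<longrightarrow> T = S)"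
proof -
  have psubset: "vec_support (path_codeword n T) \<subset> vec_support (path_codeword n S) \<longleftrightarrow>
      T \<subseteq> S \<and> odd_vertices n T \<subseteq> odd_vertices n S \<and> T \<noteq> S" if "T \<subseteq> {..<n}" for T
    using vec_support_path_codeword_mono_iff[OF assms that]
      vec_support_path_codeword_mono_iff[OF that assms] by auto
  have "minimal_codeword (graph_code (path_graph n)) (path_codeword n S) \<longleftrightarrow>
      S \<noteq> {} \<and> \<not> (\<exists>T \<in> Pow {..<n}. T \<noteq> {} \<and>
        T \<subseteq> S \<and> odd_vertices n T \<subseteq> odd_vertices n S \<and> T \<noteq> S)"
    unfolding minimal_codeword_def graph_code_path using assms
    by (auto simp: path_codeword_eq_0_iff psubset)
  moreover have "T \<in> Pow {..<n}" if "T \<subseteq> S" for T using that assms by simp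
  ultimately show ?thesis by meson
qed

section \<open>Minimal codewords are progressions\<close>

text \<open>The progression \<open>a, a + 2, \<dots>, a + 2 m\<close>, which has \<open>m + 1\<close> elements.\<close>

definition step_two :: "nat \<Rightarrow> nat \<Rightarrow> nat set" where
  "step_two a m = (\<lambda>i. a + 2 * i) ` {..m}"

text \<open>Progressions are connected at distance two, hence they give minimal codewords.\<close>

lemma step_two_parts_trivial:
  assumes bound: "a + 2 * m < n"
    and T: "T \<noteq> {}" "T \<subseteq> step_two a m" "odd_vertices n T \<subseteq> odd_vertices n (step_two a m)"
  shows "T = step_two a m"
proof -
  have step: "a + 2 * i \<in> T \<longleftrightarrow> a + 2 * Suc i \<in> T" if "i < m" for i
  proof -
    \<comment> \<open>Both neighbours of \<open>a + 2 * i + 1\<close> lie in the progression, so this vertex is not odd.\<close>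
    let ?k = "Suc (a + 2 * i)"
    have "a + 2 * i \<in> step_two a m" "a + 2 * Suc i \<in> step_two a m"
      using that unfolding step_two_def by (intro imageI; simp)+
    then have "?k \<notin> odd_vertices n (step_two a m)"
      by (simp add: odd_vertices_def image_iff)
    then have "?k \<notin> odd_vertices n T" using T by auto
    moreover have "?k < n" using that bound by simp
    ultimately show ?thesis by (auto simp: odd_vertices_def)
  qed
  have all: "a + 2 * i \<in> T \<longleftrightarrow> a \<in> T" if "i \<le> m" for i
    using that
  proof (induction i)
    case (Suc i)
    then show ?case using step[of i] by linarith
  qed simp
  obtain i where "i \<le> m" "a + 2 * i \<in> T"
    using T by (auto simp: step_two_def)
  then show ?thesis using T all by (auto simp: step_two_def)
qed

text \<open>Every nonempty set has a connected component at distance two that is a progression, namely the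
  one of its least element.\<close>

lemma exists_step_two_part:
  assumes "S \<subseteq> {..<n}" "S \<noteq> {}"
  obtains a m where "step_two a m \<subseteq> S" "odd_vertices n (step_two a m) \<subseteq> odd_vertices n S"
proof -
  have fin: "finite S" using assms finite_subset by blast
  define a where "a = Min S"
  have a: "a \<in> S" "\<And>k. k \<in> S \<Longrightarrow> a \<le> k" using fin assms by (auto simp: a_def)
  have "a + 2 * Suc n \<notin> S" using assms by auto
  then have ex: "\<exists>m. a + 2 * Suc m \<notin> S" ..
  \<comment> \<open>The maximal run of elements of \<open>S\<close> at distance two that starts with the least element.\<close>
  define m where "m = (LEAST m. a + 2 * Suc m \<notin> S)"
  have m: "a + 2 * Suc m \<notin> S" unfolding m_def by (rule LeastI_ex[OF ex])
  have run: "a + 2 * i \<in> S" if "i \<le> m" for i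
  proof (cases i)
    case (Suc l)
    then have "l < m" using that by simp
    then show ?thesis unfolding m_def Suc by (metis not_less_Least)
  qed (use a in simp)
  have sub: "step_two a m \<subseteq> S" using run by (auto simp: step_two_def)
  have "odd_vertices n (step_two a m) \<subseteq> odd_vertices n S"
  proof
    fix k assume k: "k \<in> odd_vertices n (step_two a m)"
    then have kn: "k < n" by (simp add: odd_vertices_def)
    show "k \<in> odd_vertices n S"
    proof (cases "Suc k \<in> step_two a m")
      case True
      then obtain i where i: "Suc k = a + 2 * i" "i \<le> m" by (auto simp: step_two_def)
      have "k \<notin> Suc ` S"
      proof
        assume "k \<in> Suc ` S"
        then obtain l where l: "k = Suc l" "l \<in> S" by auto
        then have "i \<noteq> 0" using a(2)[OF l(2)] i by auto
        then have "l = a + 2 * (i - 1)" using i l by simp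
        then have "l \<in> step_two a m" using i by (auto simp: step_two_def)
        then show False using k True l by (auto simp: odd_vertices_def)
      qed
      then show ?thesis using True sub kn by (auto simp: odd_vertices_def)
    next
      case False
      then obtain i where i: "k = Suc (a + 2 * i)" "i \<le> m"
        using k by (auto simp: odd_vertices_def step_two_def)
      have "\<not> i < m"
      proof
        assume "i < m"
        then have "a + 2 * Suc i \<in> step_two a m" unfolding step_two_def by (intro imageI) simp
        then show False using False i by simp
      qed
      then have "i = m" using i by simp
      then have "Suc k \<notin> S" using m i by simp
      moreover have "k \<in> Suc ` S" using i run by auto
      ultimately show ?thesis using kn by (simp add: odd_vertices_def)
    qed
  qed
  with sub show ?thesis by (rule that)
qed

lemma step_two_nonempty: "step_two a m \<noteq> {}"
  by (simp add: step_two_def)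

lemma step_two_subset_iff: "step_two a m \<subseteq> {..<n} \<longleftrightarrow> a + 2 * m < n"
  by (auto simp: step_two_def)

lemma minimal_path_codeword_iff:
  assumes "S \<subseteq> {..<n}"
  shows "minimal_codeword (graph_code (path_graph n)) (path_codeword n S) \<longleftrightarrow>
    (\<exists>a m. S = step_two a m)"
  unfolding minimal_codeword_path_codeword_iff[OF assms]
proof
  assume "S \<noteq> {} \<and> (\<forall>T. T \<noteq> {} \<and> T \<subseteq> S \<and> odd_vertices n T \<subseteq> odd_vertices n S \<longrightarrow> T = S)"
  then show "\<exists>a m. S = step_two a m"
    using exists_step_two_part[OF assms] step_two_nonempty by metis
next
  assume "\<exists>a m. S = step_two a m"
  then obtain a m where S: "S = step_two a m" by blast
  then show "S \<noteq> {} \<and> (\<forall>T. T \<noteq> {} \<and> T \<subseteq> S \<and> odd_vertices n T \<subseteq> odd_vertices n S \<longrightarrow> T = S)"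
    using assms step_two_parts_trivial[of a m n] step_two_nonempty[of a m]
    by (auto simp: step_two_subset_iff)
qed

lemma step_two_eq_iff: "step_two a m = step_two b l \<longleftrightarrow> a = b \<and> m = l"
proof
  assume eq: "step_two a m = step_two b l"
  have least: "Min (step_two a m) = a" for a m
    by (rule Min_eqI) (auto simp: step_two_def)
  have greatest: "Max (step_two a m) = a + 2 * m" for a m
    by (rule Max_eqI) (auto simp: step_two_def)
  have "a = b" using least[of a m] least[of b l] eq by simp
  moreover have "a + 2 * m = b + 2 * l" using greatest[of a m] greatest[of b l] eq by simp
  ultimately show "a = b \<and> m = l" by simp
qed auto

section \<open>Counting the progressions\<close>

lemma card_step_two_pairs: "card (SIGMA a:{..<n}. {m. a + 2 * m < n}) = (n + 1)\<^sup>2 div 4"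
proof -
  have inner: "{m. a + 2 * m < n} = {..(n - Suc a) div 2}" if "a < n" for a
  proof (rule Set.set_eqI)
    fix m
    have "m \<le> (n - Suc a) div 2 \<longleftrightarrow> m * 2 \<le> n - Suc a"
      by (rule less_eq_div_iff_mult_less_eq) simp
    also have "\<dots> \<longleftrightarrow> a + 2 * m < n" using that by linarith
    finally show "m \<in> {m. a + 2 * m < n} \<longleftrightarrow> m \<in> {..(n - Suc a) div 2}"
      by (simp only: mem_Collect_eq atMost_iff)
  qed
  have "card (SIGMA a:{..<n}. {m. a + 2 * m < n}) = (\<Sum>a<n. Suc ((n - Suc a) div 2))"
    by (subst card_SigmaI) (auto simp: inner intro!: sum.cong)
  also have "\<dots> = (\<Sum>k<n. Suc (k div 2))"
    by (rule sum.nat_diff_reindex)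
  also have "\<dots> = (n + 1)\<^sup>2 div 4"
    \<comment> \<open>From \<open>n\<close> to \<open>n + 2\<close>, both sides grow by \<open>n + 2\<close>.\<close>
  proof (induction n rule: induct_nat_012)
    case (ge2 n)
    have "(Suc (Suc n) + 1)\<^sup>2 = (n + 1)\<^sup>2 + (n + 2) * 4"
      by (simp add: power2_eq_square algebra_simps)
    then have "(Suc (Suc n) + 1)\<^sup>2 div 4 = (n + 1)\<^sup>2 div 4 + (n + 2)"
      by simp
    moreover have "Suc (n div 2) + Suc (Suc n div 2) = n + 2" by presburger
    ultimately show ?case using ge2(1) by simp
  qed (auto simp: power2_eq_square)
  finally show ?thesis .
qed

lemma num_minimal_codewords_path: "num_minimal_codewords (path_graph n) = (n + 1)\<^sup>2 div 4"
proof -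
  let ?P = "SIGMA a:{..<n}. {m. a + 2 * m < n}"
  let ?f = "\<lambda>(a, m). step_two a m"
  have sets: "?f ` ?P \<subseteq> Pow {..<n}"
    by (auto simp: step_two_subset_iff[symmetric])
  have "{c. minimal_codeword (graph_code (path_graph n)) c} = path_codeword n ` ?f ` ?P"
  proof (intro equalityI subsetI)
    fix c assume "c \<in> {c. minimal_codeword (graph_code (path_graph n)) c}"
    then have c: "minimal_codeword (graph_code (path_graph n)) c" by simp
    then have "c \<in> path_codeword n ` Pow {..<n}"
      by (simp add: minimal_codeword_def graph_code_path)
    then obtain S where S: "S \<subseteq> {..<n}" "c = path_codeword n S" by auto
    then obtain a m where am: "S = step_two a m"
      using c minimal_path_codeword_iff by blast
    then have "a + 2 * m < n" using S by (simp add: step_two_subset_iff)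
    then have "(a, m) \<in> ?P" by simp
    then show "c \<in> path_codeword n ` ?f ` ?P" unfolding S am by force
  next
    fix c assume "c \<in> path_codeword n ` ?f ` ?P"
    then obtain a m where "c = path_codeword n (step_two a m)" "a + 2 * m < n" by auto
    then show "c \<in> {c. minimal_codeword (graph_code (path_graph n)) c}"
      by (auto simp: minimal_path_codeword_iff step_two_subset_iff)
  qed
  moreover have "card (path_codeword n ` ?f ` ?P) = card (?f ` ?P)"
    using sets inj_on_path_codeword by (intro card_image) (rule inj_on_subset)
  moreover have "card (?f ` ?P) = card ?P"
    by (intro card_image inj_onI) (auto simp: step_two_eq_iff)
  ultimately show ?thesis
    by (simp only: num_minimal_codewords_def card_step_two_pairs)
qed

lemma floor_quarter_square:
  "\<lfloor>(real n + 1)\<^sup>2 / 4\<rfloor> = \<lfloor>(real n + 1) / 2\<rfloor> * \<lceil>(real n + 1) / 2\<rceil>"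
proof (cases "even n")
  case True
  then obtain k where n: "n = 2 * k" ..
  have "\<lfloor>(real n + 1)\<^sup>2 / 4\<rfloor> = int (k * (k + 1))"
    by (rule floor_unique) (auto simp: n power2_eq_square field_simps)
  moreover have "\<lfloor>(real n + 1) / 2\<rfloor> = int k" by (rule floor_unique) (auto simp: n)
  moreover have "\<lceil>(real n + 1) / 2\<rceil> = int (k + 1)" by (rule ceiling_unique) (auto simp: n)
  ultimately show ?thesis by (simp only: of_nat_mult)
next
  case False
  then obtain k where n: "n = 2 * k + 1" using oddE by blast
  have "(real n + 1)\<^sup>2 / 4 = real ((k + 1) * (k + 1))"
    by (auto simp: n power2_eq_square field_simps)
  then have "\<lfloor>(real n + 1)\<^sup>2 / 4\<rfloor> = int ((k + 1) * (k + 1))" by (simp only: floor_of_nat)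
  moreover have "(real n + 1) / 2 = real (k + 1)" by (simp add: n)
  ultimately show ?thesis by (simp only: floor_of_nat ceiling_of_nat of_nat_mult)
qed

theorem proposition3p6:
  fixes n :: nat
  assumes "n \<ge> 1"
  shows "int (num_minimal_codewords (path_graph n)) = \<lfloor>(real n + 1)\<^sup>2 / 4\<rfloor> \<and>
         \<lfloor>(real n + 1)\<^sup>2 / 4\<rfloor> = \<lfloor>(real n + 1) / 2\<rfloor> * \<lceil>(real n + 1) / 2\<rceil>"
proof
  have "(real n + 1)\<^sup>2 / 4 = real ((n + 1)\<^sup>2) / real 4" by simp
  then show "int (num_minimal_codewords (path_graph n)) = \<lfloor>(real n + 1)\<^sup>2 / 4\<rfloor>"
    by (simp only: num_minimal_codewords_path floor_divide_of_nat_eq)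
qed (rule floor_quarter_square)

end
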